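(* The word problem in the group $B_2(\Sigma_{1,0})$ is solvable.
   Context: $B_2(\Sigma_{1,0})$ is the braid group on two strands of the torus $\Sigma_{1,0}$, i.e. the fundamental group of the configuration space of 2 unordered distinct points of the torus. It has the finite presentation $$B_2(\Sigma_{1,0})=\langle a,b,c\mid a^2b=ba^2;\ b^2a=ab^2;\ a^2c=ca^2;\ b^2c=cb^2;\ a^2b^2=c^2\rangle .$$ Solvability of the word problem means that there is an algorithm which, given a word in $a^{\pm1},b^{\pm1},c^{\pm1}$, decides whether it represents the identity element. *)

theory Defs
  imports "HOL-Algebra.Group" "HOL-Library.Nat_Bijection"
begin

section \<open>Group presentations\<close>

text \<open>A letter \<open>(x, True)\<close> stands for the generator \<open>x\<close> and \<open>(x, False)\<close> for its formal
  inverse.  A relation \<open>l = r\<close> is a pair \<open>(l, r)\<close> of words.\<close>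

type_synonym 'g word = "('g \<times> bool) list"

inductive pres_cong :: "('g word \<times> 'g word) set \<Rightarrow> 'g word \<Rightarrow> 'g word \<Rightarrow> bool"
  for R :: "('g word \<times> 'g word) set" where
  pc_refl: "pres_cong R u u"
| pc_sym: "pres_cong R u v \<Longrightarrow> pres_cong R v u"
| pc_trans: "pres_cong R u v \<Longrightarrow> pres_cong R v w \<Longrightarrow> pres_cong R u w"
| pc_append: "pres_cong R u u' \<Longrightarrow> pres_cong R v v' \<Longrightarrow> pres_cong R (u @ v) (u' @ v')"
| pc_cancel: "pres_cong R [(x, e), (x, \<not> e)] []"
| pc_rel: "(l, r) \<in> R \<Longrightarrow> pres_cong R l r"

definition pres_rel :: "('g word \<times> 'g word) set \<Rightarrow> ('g word \<times> 'g word) set" where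
  "pres_rel R = {(u, v). pres_cong R u v}"

text \<open>The group presented by the generators \<open>UNIV :: 'g set\<close> and the relations \<open>R\<close>, with
  congruence classes of words as elements.\<close>

definition presented_group :: "('g word \<times> 'g word) set \<Rightarrow> 'g word set monoid" where
  "presented_group R =
     \<lparr>carrier = UNIV // pres_rel R,
      mult = (\<lambda>U V. \<Union>u\<in>U. \<Union>v\<in>V. pres_rel R `` {u @ v}),
      one = pres_rel R `` {[]}\<rparr>"

definition pres_gen :: "('g word \<times> 'g word) set \<Rightarrow> 'g \<Rightarrow> 'g word set" where
  "pres_gen R x = pres_rel R `` {[(x, True)]}"

lemma equiv_pres_rel: "equiv UNIV (pres_rel R)"
proof (rule equivI)
  show "pres_rel R \<subseteq> UNIV \<times> UNIV" by simp
  show "refl_on UNIV (pres_rel R)"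
    by (simp add: refl_on_def pres_rel_def pc_refl)
  show "sym (pres_rel R)"
    unfolding sym_def pres_rel_def using pc_sym by fast
  show "trans (pres_rel R)"
    unfolding trans_def pres_rel_def using pc_trans by fast
qed

lemma pres_class_eq_iff: "pres_rel R `` {u} = pres_rel R `` {v} \<longleftrightarrow> pres_cong R u v"
  using eq_equiv_class_iff[OF equiv_pres_rel, of u v R] by (simp add: pres_rel_def)

lemma presented_group_mult:
  "pres_rel R `` {u} \<otimes>\<^bsub>presented_group R\<^esub> pres_rel R `` {v} = pres_rel R `` {u @ v}"
proof -
  have "pres_rel R `` {u' @ v'} = pres_rel R `` {u @ v}"
    if "u' \<in> pres_rel R `` {u}" "v' \<in> pres_rel R `` {v}" for u' v'
  proof -
    have "pres_cong R u u'" "pres_cong R v v'"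
      using that by (simp_all add: pres_rel_def)
    then show ?thesis
      unfolding pres_class_eq_iff by (intro pc_sym[OF pc_append])
  qed
  then have "(\<Union>u'\<in>pres_rel R `` {u}. \<Union>v'\<in>pres_rel R `` {v}. pres_rel R `` {u' @ v'}) =
      (\<Union>u'\<in>pres_rel R `` {u}. \<Union>v'\<in>pres_rel R `` {v}. pres_rel R `` {u @ v})"
    by (intro SUP_cong refl)
  moreover have "pres_rel R `` {x} \<noteq> {}" for x
    unfolding pres_rel_def using pc_refl by fast
  ultimately show ?thesis
    by (simp only: presented_group_def monoid.simps UN_constant if_False)
qed

lemma pres_cong_inverse: "pres_cong R (map (\<lambda>(x, e). (x, \<not> e)) (rev w) @ w) []"
proof (induction w)
  case Nil
  show ?case by (simp add: pc_refl)
next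
  case (Cons l w)
  obtain x e where l: "l = (x, e)" by (cases l)
  let ?i = "map (\<lambda>(x, e). (x, \<not> e)) (rev w)"
  have "pres_cong R ([(x, \<not> e), (x, \<not> \<not> e)] @ w) ([] @ w)"
    by (intro pc_append pc_cancel pc_refl)
  then have "pres_cong R (?i @ [(x, \<not> e), (x, e)] @ w) (?i @ w)"
    using pc_append[OF pc_refl, of R _ _ ?i] by simp
  then have "pres_cong R (?i @ [(x, \<not> e), (x, e)] @ w) []"
    using Cons.IH by (rule pc_trans)
  then show ?case
    by (simp add: l)
qed

lemma group_presented_group: "group (presented_group R)"
proof (rule groupI)
  have carr: "\<exists>u. U = pres_rel R `` {u}" if "U \<in> carrier (presented_group R)" for U
    using that by (auto simp: presented_group_def quotient_def)
  have clos: "pres_rel R `` {u} \<in> carrier (presented_group R)" for u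
    by (auto simp: presented_group_def quotient_def)
  have one: "\<one>\<^bsub>presented_group R\<^esub> = pres_rel R `` {[]}"
    by (simp add: presented_group_def)
  show "\<one>\<^bsub>presented_group R\<^esub> \<in> carrier (presented_group R)"
    by (simp add: one clos)
  fix U assume "U \<in> carrier (presented_group R)"
  then obtain u where u: "U = pres_rel R `` {u}" using carr by blast
  show "\<one>\<^bsub>presented_group R\<^esub> \<otimes>\<^bsub>presented_group R\<^esub> U = U"
    by (simp add: one u presented_group_mult)
  show "\<exists>V\<in>carrier (presented_group R). V \<otimes>\<^bsub>presented_group R\<^esub> U = \<one>\<^bsub>presented_group R\<^esub>"
    using pres_cong_inverse[of R u]
    by (intro bexI[OF _ clos]) (simp add: one u presented_group_mult pres_class_eq_iff)
  fix V assume "V \<in> carrier (presented_group R)"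
  then obtain v where v: "V = pres_rel R `` {v}" using carr by blast
  show "U \<otimes>\<^bsub>presented_group R\<^esub> V \<in> carrier (presented_group R)"
    by (simp add: u v presented_group_mult clos)
  fix W assume "W \<in> carrier (presented_group R)"
  then obtain w where w: "W = pres_rel R `` {w}" using carr by blast
  show "U \<otimes>\<^bsub>presented_group R\<^esub> V \<otimes>\<^bsub>presented_group R\<^esub> W =
        U \<otimes>\<^bsub>presented_group R\<^esub> (V \<otimes>\<^bsub>presented_group R\<^esub> W)"
    by (simp add: u v w presented_group_mult)
qed


section \<open>Partial recursive functions\<close>

datatype recfun =
    Zero
  | Succ
  | Proj nat
  | Comp recfun "recfun list"
  | PrimRec recfun recfun
  | Mini recfun

text \<open>\<open>rec_eval f xs y\<close> means that \<open>f\<close> is defined on the argument tuple \<open>xs\<close> with value \<open>y\<close>.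
  In \<open>PrimRec f g\<close> the recursion runs over the first argument; \<open>Mini f\<close> is Kleene's unbounded
  minimisation over the first argument of \<open>f\<close>.\<close>

inductive rec_eval :: "recfun \<Rightarrow> nat list \<Rightarrow> nat \<Rightarrow> bool" where
  re_Zero: "rec_eval Zero xs 0"
| re_Succ: "rec_eval Succ [x] (Suc x)"
| re_Proj: "i < length xs \<Longrightarrow> rec_eval (Proj i) xs (xs ! i)"
| re_Comp: "\<lbrakk>length ys = length gs; \<forall>i<length gs. rec_eval (gs ! i) xs (ys ! i); rec_eval f ys z\<rbrakk>
    \<Longrightarrow> rec_eval (Comp f gs) xs z"
| re_PrimRec_0: "rec_eval f xs y \<Longrightarrow> rec_eval (PrimRec f g) (0 # xs) y"
| re_PrimRec_Suc: "\<lbrakk>rec_eval (PrimRec f g) (n # xs) r; rec_eval g (n # r # xs) y\<rbrakk>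
    \<Longrightarrow> rec_eval (PrimRec f g) (Suc n # xs) y"
| re_Mini: "\<lbrakk>rec_eval f (n # xs) 0; \<forall>m<n. \<exists>k. rec_eval f (m # xs) (Suc k)\<rbrakk>
    \<Longrightarrow> rec_eval (Mini f) xs n"

lemma rec_eval_deterministic: "rec_eval f xs y \<Longrightarrow> rec_eval f xs z \<Longrightarrow> y = z"
proof (induction f xs y arbitrary: z rule: rec_eval.induct)
  case (re_Zero xs)
  from re_Zero.prems show ?case by cases simp_all
next
  case (re_Succ x)
  from re_Succ.prems show ?case by cases simp_all
next
  case (re_Proj i xs)
  from re_Proj.prems show ?case by cases simp_all
next
  case (re_Comp ys gs xs f y)
  from re_Comp.prems obtain ys' where ys': "length ys' = length gs"
    "\<forall>i<length gs. rec_eval (gs ! i) xs (ys' ! i)" "rec_eval f ys' z"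
    by cases
  have "ys = ys'"
  proof (rule nth_equalityI)
    show "length ys = length ys'" using re_Comp.hyps(1) ys'(1) by simp
    show "ys ! i = ys' ! i" if "i < length ys" for i
      using re_Comp.IH(1) re_Comp.hyps(1) ys'(2) that by auto
  qed
  with ys'(3) have "rec_eval f ys z" by simp
  then show ?case by (rule re_Comp.IH(2))
next
  case (re_PrimRec_0 f xs y g)
  from re_PrimRec_0.prems have "rec_eval f xs z" by cases
  then show ?case by (rule re_PrimRec_0.IH)
next
  case (re_PrimRec_Suc f g n xs r y)
  from re_PrimRec_Suc.prems obtain r' where
    r': "rec_eval (PrimRec f g) (n # xs) r'" "rec_eval g (n # r' # xs) z"
    by cases
  have "r = r'" using r'(1) by (rule re_PrimRec_Suc.IH(1))
  with r'(2) have "rec_eval g (n # r # xs) z" by simp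
  then show ?case by (rule re_PrimRec_Suc.IH(2))
next
  case (re_Mini f n xs)
  from re_Mini.prems have z: "rec_eval f (z # xs) 0" by cases simp_all
  from re_Mini.prems have z': "\<forall>m<z. \<exists>k. rec_eval f (m # xs) (Suc k)" by cases
  have "\<not> z < n"
  proof
    assume "z < n"
    then obtain k where "\<forall>y. rec_eval f (z # xs) y \<longrightarrow> Suc k = y"
      using re_Mini.IH(2) by blast
    with z show False by blast
  qed
  moreover have "\<not> n < z"
  proof
    assume "n < z"
    then obtain k where "rec_eval f (n # xs) (Suc k)"
      using z' by blast
    then have "0 = Suc k" by (rule re_Mini.IH(1))
    then show False by simp
  qed
  ultimately show ?case by simp
qed


section \<open>The word problem\<close>

definition letter_value :: "('a, 'm) monoid_scheme \<Rightarrow> ('g \<Rightarrow> 'a) \<Rightarrow> 'g \<times> bool \<Rightarrow> 'a" where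
  "letter_value G gen l = (if snd l then gen (fst l) else inv\<^bsub>G\<^esub> gen (fst l))"

definition word_value :: "('a, 'm) monoid_scheme \<Rightarrow> ('g \<Rightarrow> 'a) \<Rightarrow> 'g word \<Rightarrow> 'a" where
  "word_value G gen w = foldr (\<lambda>l r. letter_value G gen l \<otimes>\<^bsub>G\<^esub> r) w \<one>\<^bsub>G\<^esub>"

text \<open>Words are presented to an algorithm as natural numbers: given an injective numbering \<open>num\<close> of the
  generators, the word is the library's \<open>list_encode\<close> of the list of the numbers of its letters.\<close>

definition word_code :: "('g \<Rightarrow> nat) \<Rightarrow> 'g word \<Rightarrow> nat" where
  "word_code num w = list_encode (map (\<lambda>(x, e). 2 * num x + of_bool e) w)"

text \<open>The algorithm is a partial recursive function that halts on the code of every word, with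
  output 1 if the word represents the identity element and 0 otherwise.\<close>

definition solvable_word_problem ::
    "('g \<Rightarrow> nat) \<Rightarrow> ('a, 'm) monoid_scheme \<Rightarrow> ('g \<Rightarrow> 'a) \<Rightarrow> bool" where
  "solvable_word_problem num G gen \<longleftrightarrow>
     (\<exists>f. \<forall>w. rec_eval f [word_code num w] (if word_value G gen w = \<one>\<^bsub>G\<^esub> then 1 else 0))"


section \<open>The two-strand braid group of the torus\<close>

datatype torus_gen = A | B | C

fun torus_gen_num :: "torus_gen \<Rightarrow> nat" where
  "torus_gen_num A = 0"
| "torus_gen_num B = 1"
| "torus_gen_num C = 2"

abbreviation pos_word :: "'g list \<Rightarrow> 'g word" where
  "pos_word xs \<equiv> map (\<lambda>x. (x, True)) xs"

definition B2_torus_relations :: "(torus_gen word \<times> torus_gen word) set" where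
  "B2_torus_relations =
     {(pos_word [A, A, B], pos_word [B, A, A]),
      (pos_word [B, B, A], pos_word [A, B, B]),
      (pos_word [A, A, C], pos_word [C, A, A]),
      (pos_word [B, B, C], pos_word [C, B, B]),
      (pos_word [A, A, B, B], pos_word [C, C])}"

text \<open>The fundamental group of the configuration space of two unordered distinct points of the
  torus, given by its known finite presentation.  The word problem is taken with respect to the
  generators of this presentation.\<close>

definition B2_torus :: "torus_gen word set monoid" where
  "B2_torus = presented_group B2_torus_relations"

definition B2_torus_gen :: "torus_gen \<Rightarrow> torus_gen word set" where
  "B2_torus_gen = pres_gen B2_torus_relations"

end

theory Submission imports Defs begin

text \<open>The subgroup generated by \<open>a\<^sup>2\<close> and \<open>b\<^sup>2\<close> is central, and the quotient by it is the free
  product of three copies of \<open>\<int>/2\<close>, in which the word problem is solved by cancelling equal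
  neighbours on a stack.  The kernel is detected by the two homomorphisms to \<open>\<int>\<close> that send
  \<open>a, b, c\<close> to \<open>1, 0, 1\<close> and to \<open>0, 1, 1\<close>.  So a word is trivial iff the stack is empty
  after reading it and both of its exponent sums vanish.\<close>

section \<open>Recursive functions\<close>

text \<open>Only argument lists of length \<open>n\<close> are constrained, so \<open>F\<close> may
  be written with \<open>!\<close>, \<open>hd\<close> and \<open>tl\<close>, whatever these yield on
  shorter lists.\<close>

definition recursive :: "nat \<Rightarrow> (nat list \<Rightarrow> nat) \<Rightarrow> bool" where
  "recursive n F \<longleftrightarrow> (\<exists>f. \<forall>xs. length xs = n \<longrightarrow> rec_eval f xs (F xs))"

lemma recursiveI: "(\<And>xs. length xs = n \<Longrightarrow> rec_eval f xs (F xs)) \<Longrightarrow> recursive n F"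
  unfolding recursive_def by blast

lemma recursive_cong: "recursive n F \<Longrightarrow> (\<And>xs. length xs = n \<Longrightarrow> F xs = G xs) \<Longrightarrow> recursive n G"
  unfolding recursive_def by metis

lemma recursive_proj: "i < n \<Longrightarrow> recursive n (\<lambda>xs. xs ! i)"
  by (intro recursiveI[of _ "Proj i"]) (auto intro: re_Proj)

lemma recursive_compose:
  assumes G: "recursive k G" and Fs: "length Fs = k" "\<And>F. F \<in> set Fs \<Longrightarrow> recursive n F"
  shows "recursive n (\<lambda>xs. G (map (\<lambda>F. F xs) Fs))"
proof -
  obtain g where g: "\<And>ys. length ys = k \<Longrightarrow> rec_eval g ys (G ys)"
    using G unfolding recursive_def by blast
  obtain c where c: "\<And>F xs. F \<in> set Fs \<Longrightarrow> length xs = n \<Longrightarrow> rec_eval (c F) xs (F xs)"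
    using Fs(2) unfolding recursive_def by metis
  show ?thesis
  proof (rule recursiveI[of _ "Comp g (map c Fs)"])
    fix xs :: "nat list" assume "length xs = n"
    then show "rec_eval (Comp g (map c Fs)) xs (G (map (\<lambda>F. F xs) Fs))"
      by (intro re_Comp[of "map (\<lambda>F. F xs) Fs"]) (simp_all add: c g Fs(1))
  qed
qed

text \<open>This form and the next two reduce a closure property to the case where the arguments are
  plain projections.\<close>

lemma recursive_compose1:
  "recursive 1 (\<lambda>xs. h (xs ! 0)) \<Longrightarrow> recursive n F \<Longrightarrow> recursive n (\<lambda>xs. h (F xs))"
  using recursive_compose[of 1 "\<lambda>xs. h (xs ! 0)" "[F]" n] by simp

lemma recursive_compose2:
  "recursive 2 (\<lambda>xs. h (xs ! 0) (xs ! 1)) \<Longrightarrow> recursive n F \<Longrightarrow> recursive n G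
    \<Longrightarrow> recursive n (\<lambda>xs. h (F xs) (G xs))"
  using recursive_compose[of 2 "\<lambda>xs. h (xs ! 0) (xs ! 1)" "[F, G]" n] by auto

lemma recursive_compose3:
  "recursive 3 (\<lambda>xs. h (xs ! 0) (xs ! 1) (xs ! 2)) \<Longrightarrow> recursive n F \<Longrightarrow> recursive n G
    \<Longrightarrow> recursive n H \<Longrightarrow> recursive n (\<lambda>xs. h (F xs) (G xs) (H xs))"
  using recursive_compose[of 3 "\<lambda>xs. h (xs ! 0) (xs ! 1) (xs ! 2)" "[F, G, H]" n]
  by (auto simp: numeral_2_eq_2)

lemma recursive_Suc: "recursive n F \<Longrightarrow> recursive n (\<lambda>xs. Suc (F xs))"
  by (rule recursive_compose1[of Suc], rule recursiveI[of _ Succ])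
    (auto simp: length_Suc_conv intro: re_Succ)

lemma recursive_const: "recursive n (\<lambda>xs. k)"
  by (induction k) (auto intro: recursive_Suc recursiveI[of _ Zero] re_Zero)

lemma recursive_primrec:
  assumes "recursive n F" and "recursive (Suc (Suc n)) G"
  shows "recursive (Suc n) (\<lambda>xs. rec_nat (F (tl xs)) (\<lambda>m r. G (m # r # tl xs)) (hd xs))"
proof -
  obtain f g where f: "\<And>xs. length xs = n \<Longrightarrow> rec_eval f xs (F xs)"
    and g: "\<And>xs. length xs = Suc (Suc n) \<Longrightarrow> rec_eval g xs (G xs)"
    using assms unfolding recursive_def by blast
  have "rec_eval (PrimRec f g) (m # ys) (rec_nat (F ys) (\<lambda>m r. G (m # r # ys)) m)"
    if "length ys = n" for m ys
  proof (induction m)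
    case 0
    show ?case using re_PrimRec_0 f that by simp
  next
    case (Suc m)
    from Suc.IH g show ?case
      \<comment> \<open>\<open>old.nat.simps(7)\<close> is the \<open>Suc\<close> equation of
        \<open>rec_nat\<close>.\<close>
      unfolding old.nat.simps(7) by (rule re_PrimRec_Suc) (simp add: that)
  qed
  then show ?thesis
    by (intro recursiveI[of _ "PrimRec f g"]) (auto simp: length_Suc_conv)
qed

text \<open>The means of inverting a monotone function: \<open>G\<close> is characterised as the
  least zero of \<open>F\<close>. It yields halving and the diagonal of the Cantor pairing.\<close>

lemma recursive_minimum:
  assumes "recursive (Suc n) F"
    and "\<And>xs. length xs = n \<Longrightarrow> F (G xs # xs) = 0"
    and "\<And>xs m. length xs = n \<Longrightarrow> m < G xs \<Longrightarrow> F (m # xs) > 0"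
  shows "recursive n G"
proof -
  obtain f where f: "\<And>xs. length xs = Suc n \<Longrightarrow> rec_eval f xs (F xs)"
    using assms(1) unfolding recursive_def by blast
  show ?thesis
  proof (rule recursiveI[of _ "Mini f"], rule re_Mini)
    fix xs :: "nat list" assume xs: "length xs = n"
    then show "rec_eval f (G xs # xs) 0"
      using f[of "G xs # xs"] assms(2)[of xs] by simp
    show "\<forall>m<G xs. \<exists>k. rec_eval f (m # xs) (Suc k)"
    proof (intro allI impI)
      fix m assume "m < G xs"
      with xs have "F (m # xs) > 0"
        by (rule assms(3))
      then obtain k where "F (m # xs) = Suc k"
        using gr0_implies_Suc by blast
      then show "\<exists>k. rec_eval f (m # xs) (Suc k)"
        using f[of "m # xs"] xs by (intro exI[of _ k]) simp
    qed
  qed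
qed

text \<open>Iteration is primitive recursion whose step ignores the counter. Addition, subtraction
  and the loop over a coded list are instances.\<close>

lemma recursive_funpow:
  assumes "recursive 1 (\<lambda>xs. h (xs ! 0))" "recursive n F" "recursive n M"
  shows "recursive n (\<lambda>xs. (h ^^ M xs) (F xs))"
proof -
  have "recursive (Suc 1) (\<lambda>xs. rec_nat (tl xs ! 0) (\<lambda>m r. h ((m # r # tl xs) ! 1)) (hd xs))"
    by (rule recursive_primrec[of 1 "\<lambda>xs. xs ! 0" "\<lambda>xs. h (xs ! 1)"])
      (auto intro: recursive_proj recursive_compose1[OF assms(1)])
  moreover have "rec_nat x (\<lambda>m r. h r) k = (h ^^ k) x" for x k
    by (induction k) auto
  ultimately have "recursive 2 (\<lambda>xs. (h ^^ (xs ! 0)) (xs ! 1))"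
    by (auto elim!: recursive_cong simp: numeral_2_eq_2 length_Suc_conv)
  then show ?thesis
    using recursive_compose2[of "\<lambda>m x. (h ^^ m) x" n M F] assms(2,3) by simp
qed

section \<open>Arithmetic and case distinctions\<close>

lemma recursive_add:
  assumes "recursive n F" "recursive n G"
  shows "recursive n (\<lambda>xs. F xs + G xs)"
proof -
  have "(Suc ^^ m) k = m + k" for m k
    by (induction m) auto
  then show ?thesis
    using recursive_funpow[of Suc n G F] assms recursive_Suc[OF recursive_proj[of 0 1]] by simp
qed

lemma recursive_pred:
  assumes "recursive n F"
  shows "recursive n (\<lambda>xs. F xs - 1)"
proof (rule recursive_compose1[OF _ assms])
  \<comment> \<open>The step returns the counter and discards the previous value; the value at 0
    agrees with truncated subtraction.\<close>
  have "recursive (Suc 0) (\<lambda>xs. rec_nat 0 (\<lambda>m r. (m # r # tl xs) ! 0) (hd xs))"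
    by (rule recursive_primrec[OF recursive_const recursive_proj]) simp
  moreover have "rec_nat 0 (\<lambda>m r. m) k = k - 1" for k :: nat
    by (cases k) auto
  ultimately show "recursive 1 (\<lambda>xs. xs ! 0 - 1)"
    by (auto elim!: recursive_cong simp: length_Suc_conv)
qed

lemma recursive_diff:
  assumes "recursive n F" "recursive n G"
  shows "recursive n (\<lambda>xs. F xs - G xs)"
proof -
  have "((\<lambda>x. x - 1) ^^ m) k = k - m" for m k :: nat
    by (induction m) auto
  then show ?thesis
    using recursive_funpow[of "\<lambda>x. x - 1" n F G] assms recursive_pred[OF recursive_proj[of 0 1]]
    by simp
qed

lemma recursive_if_zero:
  assumes "recursive n F" "recursive n G" "recursive n H"
  shows "recursive n (\<lambda>xs. if F xs = 0 then G xs else H xs)"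
proof -
  \<comment> \<open>Recursion on the condition: position 3 of \<open>m # r # tl xs\<close> is
    position 1 of \<open>tl xs\<close>, the branch for nonzero values.\<close>
  have "recursive (Suc 2) (\<lambda>xs. rec_nat (tl xs ! 0) (\<lambda>m r. (m # r # tl xs) ! 3) (hd xs))"
    by (rule recursive_primrec[OF recursive_proj recursive_proj]) auto
  moreover have "rec_nat x (\<lambda>m r. y) k = (if k = 0 then x else y)" for x y k :: nat
    by (cases k) auto
  ultimately have "recursive 3 (\<lambda>xs. if xs ! 0 = 0 then xs ! 1 else xs ! 2)"
    by (auto elim!: recursive_cong simp: length_Suc_conv numeral_3_eq_3 numeral_2_eq_2)
  from recursive_compose3[OF this assms] show ?thesis .
qed

lemma recursive_if_eq:
  assumes "recursive n F" "recursive n G" "recursive n H" "recursive n K"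
  shows "recursive n (\<lambda>xs. if F xs = G xs then H xs else K xs)"
proof -
  have "(F xs - G xs) + (G xs - F xs) = 0 \<longleftrightarrow> F xs = G xs" for xs
    by auto
  then show ?thesis
    using recursive_if_zero[OF recursive_add[OF recursive_diff[OF assms(1,2)]
          recursive_diff[OF assms(2,1)]] assms(3,4)]
    by simp
qed

lemma recursive_div2:
  assumes "recursive n F"
  shows "recursive n (\<lambda>xs. F xs div 2)"
proof (rule recursive_compose1[OF _ assms])
  \<comment> \<open>\<open>x div 2\<close> is the least \<open>q\<close> with x \<le> 2q +
    1.\<close>
  have "recursive (Suc 1) (\<lambda>xs. xs ! 1 - Suc (xs ! 0 + xs ! 0))"
    by (intro recursive_diff recursive_Suc recursive_add recursive_proj) auto
  then show "recursive 1 (\<lambda>xs. xs ! 0 div 2)"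
    by (rule recursive_minimum) auto
qed

section \<open>Cantor's pairing function and its inverse\<close>

lemma recursive_triangle:
  assumes "recursive n F"
  shows "recursive n (\<lambda>xs. triangle (F xs))"
proof (rule recursive_compose1[OF _ assms])
  have "recursive (Suc 0) (\<lambda>xs. rec_nat 0
      (\<lambda>m r. (m # r # tl xs) ! 1 + Suc ((m # r # tl xs) ! 0)) (hd xs))"
    by (rule recursive_primrec[where G = "\<lambda>xs. xs ! 1 + Suc (xs ! 0)"])
      (intro recursive_const recursive_Suc recursive_add recursive_proj; simp)+
  moreover have "rec_nat 0 (\<lambda>m r. r + Suc m) k = triangle k" for k
    by (induction k) auto
  ultimately show "recursive 1 (\<lambda>xs. triangle (xs ! 0))"
    by (auto elim!: recursive_cong simp: length_Suc_conv)
qed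

lemma recursive_prod_encode:
  "recursive n F \<Longrightarrow> recursive n G \<Longrightarrow> recursive n (\<lambda>xs. prod_encode (F xs, G xs))"
  unfolding prod_encode_def prod.case by (intro recursive_add recursive_triangle)

lemma triangle_mono: "m \<le> n \<Longrightarrow> triangle m \<le> triangle n"
  by (induction n) (auto simp: le_Suc_eq)

lemma prod_decode_triangle: "prod_decode k = (x, y) \<Longrightarrow> k = triangle (x + y) + x"
  using prod_decode_inverse[of k] by (simp add: prod_encode_def)

text \<open>\<open>prod_encode (x, y)\<close> lies between \<open>triangle (x + y)\<close> and \<open>triangle (x + y + 1)\<close>,
  which determines \<open>x + y\<close>.\<close>

lemma recursive_prod_decode_sum:
  assumes "recursive n F"
  shows "recursive n (\<lambda>xs. case prod_decode (F xs) of (x, y) \<Rightarrow> x + y)"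
proof (rule recursive_compose1[OF _ assms])
  \<comment> \<open>The sum is the least \<open>s\<close> with \<open>k < triangle (s + 1)\<close>;
    the outer \<open>Suc\<close> turns this strict inequality into a vanishing truncated
    difference.\<close>
  have "recursive (Suc 1) (\<lambda>xs. Suc (xs ! 1) - triangle (Suc (xs ! 0)))"
    by (intro recursive_diff recursive_Suc recursive_triangle recursive_proj) auto
  then show "recursive 1 (\<lambda>xs. case prod_decode (xs ! 0) of (x, y) \<Rightarrow> x + y)"
  proof (rule recursive_minimum)
    fix xs :: "nat list"
    obtain x y where xy: "prod_decode (xs ! 0) = (x, y)"
      by (rule prod.exhaust)
    then have xs: "xs ! 0 = triangle (x + y) + x"
      by (rule prod_decode_triangle)
    show "Suc (((case prod_decode (xs ! 0) of (x, y) \<Rightarrow> x + y) # xs) ! 1) -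
        triangle (Suc (((case prod_decode (xs ! 0) of (x, y) \<Rightarrow> x + y) # xs) ! 0)) = 0"
      unfolding xy prod.case using xs by simp
    fix m assume "m < (case prod_decode (xs ! 0) of (x, y) \<Rightarrow> x + y)"
    then have "triangle (Suc m) \<le> triangle (x + y)"
      unfolding xy prod.case by (intro triangle_mono) simp
    then show "Suc ((m # xs) ! 1) - triangle (Suc ((m # xs) ! 0)) > 0"
      using xs by simp
  qed
qed

lemma recursive_prod_decode:
  assumes "recursive n F"
  shows "recursive n (\<lambda>xs. fst (prod_decode (F xs)))" "recursive n (\<lambda>xs. snd (prod_decode (F xs)))"
proof -
  let ?s = "\<lambda>xs. case prod_decode (F xs) of (x, y) \<Rightarrow> x + y"
  have fst: "fst (prod_decode k) = k - triangle (case prod_decode k of (x, y) \<Rightarrow> x + y)" for k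
    by (cases "prod_decode k") (auto dest: prod_decode_triangle)
  have "recursive n (\<lambda>xs. F xs - triangle (?s xs))"
    by (intro recursive_diff recursive_triangle recursive_prod_decode_sum assms)
  then show 1: "recursive n (\<lambda>xs. fst (prod_decode (F xs)))"
    by (simp only: fst[symmetric])
  have "recursive n (\<lambda>xs. ?s xs - fst (prod_decode (F xs)))"
    by (intro recursive_diff recursive_prod_decode_sum assms 1)
  then show "recursive n (\<lambda>xs. snd (prod_decode (F xs)))"
    by (simp add: case_prod_unfold)
qed

section \<open>Loops over coded lists\<close>

lemma length_le_list_encode: "length xs \<le> list_encode xs"
proof (induction xs)
  case (Cons x xs)
  then show ?case
    using le_prod_encode_2[of "list_encode xs" x] by simp
qed simp

text \<open>The loop state pairs the code of the remaining list with the accumulator. A state with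
  empty list is fixed by \<open>step\<close>, so surplus iterations are harmless and the code of the
  list, which bounds its length, can serve as the iteration count.\<close>

lemma recursive_fold:
  assumes g: "recursive 2 (\<lambda>xs. g (xs ! 0) (xs ! 1))" and F: "recursive n F"
  shows "recursive n (\<lambda>xs. fold g (list_decode (F xs)) s)"
proof -
  \<comment> \<open>The code 0 is the empty list; a nonempty list has the successor of the code of
    its head and tail, hence the predecessor before decoding.\<close>
  define step where "step p = (if fst (prod_decode p) = 0 then p
    else prod_encode (snd (prod_decode (fst (prod_decode p) - 1)),
      g (fst (prod_decode (fst (prod_decode p) - 1))) (snd (prod_decode p))))" for p
  have step: "recursive 1 (\<lambda>xs. step (xs ! 0))"
    unfolding step_def
    by (intro recursive_if_zero recursive_prod_encode recursive_prod_decode recursive_pred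
        recursive_compose2[OF g] recursive_proj) auto
  have run: "(step ^^ k) (prod_encode (list_encode ys, t)) = prod_encode (0, fold g ys t)"
    if "length ys \<le> k" for k ys t
    using that
  proof (induction k arbitrary: ys t)
    case (Suc k)
    have "step (prod_encode (list_encode ys, t)) = (case ys of
        [] \<Rightarrow> prod_encode (list_encode [], t) | y # ys \<Rightarrow> prod_encode (list_encode ys, g y t))"
      by (simp add: step_def split: list.split)
    then show ?case
      using Suc.IH[of "[]" t] Suc.IH[of "tl ys" "g (hd ys) t"] Suc.prems
      by (cases ys) (simp_all add: funpow_Suc_right del: funpow.simps)
  qed simp
  have "recursive n (\<lambda>xs. snd (prod_decode ((step ^^ F xs) (prod_encode (F xs, s)))))"
    by (intro recursive_prod_decode recursive_funpow[OF step] recursive_prod_encode recursive_const F)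
  moreover have "(step ^^ k) (prod_encode (k, s)) = prod_encode (0, fold g (list_decode k) s)" for k
    using run[of "list_decode k" k s] length_le_list_encode[of "list_decode k"] by simp
  ultimately show ?thesis
    by simp
qed

lemma recursive_sum_list:
  assumes "recursive 1 (\<lambda>xs. h (xs ! 0))" and F: "recursive n F"
  shows "recursive n (\<lambda>xs. \<Sum>x\<leftarrow>list_decode (F xs). h x)"
proof -
  have "fold (\<lambda>x r. h x + r) ys s = sum_list (map h ys) + s" for ys s
    by (induction ys arbitrary: s) auto
  then have "fold (\<lambda>x r. h x + r) ys 0 = sum_list (map h ys)" for ys
    by simp
  moreover have "recursive n (\<lambda>xs. fold (\<lambda>x r. h x + r) (list_decode (F xs)) 0)"
    by (intro recursive_fold F recursive_add recursive_compose1[OF assms(1)] recursive_proj) auto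
  ultimately show ?thesis
    by simp
qed


section \<open>Free products of groups of order two\<close>

text \<open>Multiplication of a reduced word by an involution, with the head of the list as the end
  of the word. Reduced means \<open>distinct_adj\<close>.\<close>

fun toggle :: "'a \<Rightarrow> 'a list \<Rightarrow> 'a list" where
  "toggle x [] = [x]"
| "toggle x (y # ys) = (if x = y then ys else x # y # ys)"

lemma distinct_adj_toggle: "distinct_adj ys \<Longrightarrow> distinct_adj (toggle x ys)"
  by (cases ys) (auto dest: distinct_adj_ConsD)

lemma distinct_adj_fold_toggle: "distinct_adj ys \<Longrightarrow> distinct_adj (fold toggle xs ys)"
  by (induction xs arbitrary: ys) (auto simp: distinct_adj_toggle)

text \<open>Reducedness is essential: toggling \<open>x\<close> twice on \<open>x # x # t\<close>
  gives \<open>t\<close>.\<close>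

lemma toggle_toggle: "distinct_adj ys \<Longrightarrow> toggle x (toggle x ys) = ys"
  by (cases ys rule: remdups_adj.cases) auto

text \<open>The algorithm keeps numbers of generators on its stack; injectivity of the numbering
  carries the result back to generators.\<close>

lemma map_toggle: "inj f \<Longrightarrow> map f (toggle x ys) = toggle (f x) (map f ys)"
  by (cases ys) (auto dest: injD)

lemma map_fold_toggle: "inj f \<Longrightarrow> map f (fold toggle xs ys) = fold toggle (map f xs) (map f ys)"
  by (induction xs arbitrary: ys) (auto simp: map_toggle)

lemma recursive_fold_toggle:
  assumes "recursive 1 (\<lambda>xs. h (xs ! 0))" and F: "recursive n F"
  shows "recursive n (\<lambda>xs. list_encode (fold toggle (map h (list_decode (F xs))) []))"
proof -
  \<comment> \<open>\<open>g\<close> performs \<open>toggle\<close> on codes: \<open>p = 0\<close>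
    is the empty stack, otherwise \<open>p - 1\<close> codes the pair of top and rest.\<close>
  define g where "g x p = (if p = 0 then Suc (prod_encode (h x, p))
    else if fst (prod_decode (p - 1)) = h x then snd (prod_decode (p - 1))
    else Suc (prod_encode (h x, p)))" for x p
  have "recursive 2 (\<lambda>xs. g (xs ! 0) (xs ! 1))"
    unfolding g_def
    by (intro recursive_if_zero recursive_if_eq recursive_Suc recursive_prod_encode
        recursive_prod_decode recursive_pred recursive_compose1[OF assms(1)] recursive_proj) auto
  then have fold: "recursive n (\<lambda>xs. fold g (list_decode (F xs)) (list_encode []))"
    by (intro recursive_fold F)
  have "g x (list_encode ys) = list_encode (toggle (h x) ys)" for x ys
    by (cases ys) (auto simp: g_def)
  then have "fold g xs (list_encode ys) = list_encode (fold toggle (map h xs) ys)" for xs ys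
    by (induction xs arbitrary: ys) auto
  with fold show ?thesis
    by (simp only:)
qed


section \<open>The group\<close>

text \<open>The weights serve twice: as homomorphisms to \<int>, and as the exponents of
  \<open>a\<^sup>2\<close> and \<open>b\<^sup>2\<close> in the square of each generator.\<close>

fun wt_a wt_b :: "torus_gen \<Rightarrow> int" where
  "wt_a A = 1" | "wt_a B = 0" | "wt_a C = 1"
| "wt_b A = 0" | "wt_b B = 1" | "wt_b C = 1"

section \<open>Invariants of words under the relations\<close>

definition exponent :: "('g \<Rightarrow> int) \<Rightarrow> 'g word \<Rightarrow> int" where
  "exponent wt u = (\<Sum>(x, e)\<leftarrow>u. if e then wt x else - wt x)"

lemma exponent_simps [simp]:
  "exponent wt [] = 0"
  "exponent wt ((x, e) # u) = (if e then wt x else - wt x) + exponent wt u"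
  "exponent wt (u @ v) = exponent wt u + exponent wt v"
  by (simp_all add: exponent_def)

lemma pres_cong_exponent:
  assumes "pres_cong R u v" and "\<And>l r. (l, r) \<in> R \<Longrightarrow> exponent wt l = exponent wt r"
  shows "exponent wt u = exponent wt v"
  using assms(1) by induction (auto simp: assms(2))

text \<open>Words act on reduced stacks through involutions, so a letter and its formal inverse act
  alike and cancel. The stack is arbitrary in the induction because the second factor of a product
  starts from the stack left by the first.\<close>

lemma pres_cong_fold_toggle:
  assumes "pres_cong R u v" "distinct_adj s"
    and "\<And>l r s. (l, r) \<in> R \<Longrightarrow> distinct_adj s
      \<Longrightarrow> fold toggle (map fst l) s = fold toggle (map fst r) s"
  shows "fold toggle (map fst u) s = fold toggle (map fst v) s"
  using assms(1,2)
  by (induction arbitrary: s) (auto simp: toggle_toggle distinct_adj_fold_toggle assms(3))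

text \<open>Translates triviality of a word in the group into congruence to the empty word.\<close>

lemma word_value_presented_group:
  "word_value (presented_group R) (pres_gen R) u = pres_rel R `` {u}"
proof (induction u)
  case Nil
  show ?case by (simp add: word_value_def presented_group_def)
next
  case (Cons l u)
  interpret G: group "presented_group R" by (rule group_presented_group)
  obtain x e where l: "l = (x, e)" by (cases l)
  have carr: "pres_rel R `` {v} \<in> carrier (presented_group R)" for v
    by (auto simp: presented_group_def quotient_def)
  have one: "\<one>\<^bsub>presented_group R\<^esub> = pres_rel R `` {[]}"
    by (simp add: presented_group_def)
  have "pres_rel R `` {[(x, False)]} \<otimes>\<^bsub>presented_group R\<^esub> pres_rel R `` {[(x, True)]}
      = \<one>\<^bsub>presented_group R\<^esub>"
    using pc_cancel[of R x False]
    by (simp add: one presented_group_mult pres_class_eq_iff)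
  then have "letter_value (presented_group R) (pres_gen R) l = pres_rel R `` {[l]}"
    using G.inv_equality[OF _ carr carr] by (simp add: letter_value_def l pres_gen_def)
  then show ?case
    using Cons by (simp add: word_value_def presented_group_mult)
qed

section \<open>Groups in which \<open>a\<^sup>2\<close> and \<open>b\<^sup>2\<close> are
  central\<close>

context group
begin

lemma inv_commute:
  assumes "x \<otimes> y = y \<otimes> x" "x \<in> carrier G" "y \<in> carrier G"
  shows "inv x \<otimes> y = y \<otimes> inv x"
proof -
  have "inv x \<otimes> y = inv x \<otimes> (y \<otimes> x) \<otimes> inv x"
    using assms(2,3) by (simp add: m_assoc)
  also have "\<dots> = inv x \<otimes> x \<otimes> y \<otimes> inv x"
    by (simp only: assms(1)[symmetric] m_assoc assms(2,3) m_closed inv_closed)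
  finally show ?thesis
    using assms(2,3) by simp
qed

lemma int_pow_commute:
  fixes m :: int
  assumes "x \<otimes> y = y \<otimes> x" "x \<in> carrier G" "y \<in> carrier G"
  shows "x [^] m \<otimes> y = y \<otimes> x [^] m"
proof (cases m)
  case (nonneg n)
  show ?thesis
    unfolding nonneg int_pow_int using assms by (rule group_commutes_pow)
next
  case (neg n)
  have "inv (x [^] Suc n) \<otimes> y = y \<otimes> inv (x [^] Suc n)"
    using assms by (intro inv_commute group_commutes_pow nat_pow_closed)
  then show ?thesis
    unfolding neg int_pow_neg_int[OF assms(2)] .
qed

end

text \<open>The relations as equations between group elements. The commutation laws include the
  trivial instances \<open>x = A\<close> and \<open>x = B\<close>, which makes centrality uniform in
  \<open>x\<close>.\<close>

locale square_central_group = group G for G (structure) +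
  fixes g :: "torus_gen \<Rightarrow> 'a"
  assumes closed [simp]: "g x \<in> carrier G"
    and a_comm: "g A \<otimes> g A \<otimes> g x = g x \<otimes> (g A \<otimes> g A)"
    and b_comm: "g B \<otimes> g B \<otimes> g x = g x \<otimes> (g B \<otimes> g B)"
    and c_square: "g C \<otimes> g C = g A \<otimes> g A \<otimes> (g B \<otimes> g B)"
begin

text \<open>Integer coordinates for the central subgroup, in which all central factors of a word are
  collected.\<close>

definition z :: "int \<Rightarrow> int \<Rightarrow> 'a" where
  "z m n = (g A \<otimes> g A) [^] m \<otimes> (g B \<otimes> g B) [^] n"

lemma z_closed [simp]: "z m n \<in> carrier G"
  by (simp add: z_def)

lemma z_zero [simp]: "z 0 0 = \<one>"
  by (simp add: z_def)

lemma z_commute_gen: "z m n \<otimes> g x = g x \<otimes> z m n"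
proof -
  have a: "(g A \<otimes> g A) [^] m \<otimes> g x = g x \<otimes> (g A \<otimes> g A) [^] m"
    by (intro int_pow_commute a_comm) auto
  have b: "(g B \<otimes> g B) [^] n \<otimes> g x = g x \<otimes> (g B \<otimes> g B) [^] n"
    by (intro int_pow_commute b_comm) auto
  have "z m n \<otimes> g x = (g A \<otimes> g A) [^] m \<otimes> g x \<otimes> (g B \<otimes> g B) [^] n"
    by (simp add: z_def m_assoc b)
  then show ?thesis
    by (simp add: z_def m_assoc a)
qed

lemma z_mult: "z m n \<otimes> z m' n' = z (m + m') (n + n')"
proof -
  let ?a = "g A \<otimes> g A" and ?b = "g B \<otimes> g B"
  have "?a \<otimes> ?b = ?b \<otimes> ?a"
    by (simp add: a_comm m_assoc[symmetric]) (simp add: a_comm m_assoc)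
  then have "?a [^] m' \<otimes> ?b = ?b \<otimes> ?a [^] m'"
    by (intro int_pow_commute) auto
  then have ba: "?b [^] n \<otimes> ?a [^] m' = ?a [^] m' \<otimes> ?b [^] n"
    by (intro int_pow_commute) auto
  have "z m n \<otimes> z m' n' = ?a [^] m \<otimes> (?b [^] n \<otimes> ?a [^] m') \<otimes> ?b [^] n'"
    by (simp add: z_def m_assoc)
  also have "\<dots> = ?a [^] m \<otimes> ?a [^] m' \<otimes> (?b [^] n \<otimes> ?b [^] n')"
    by (simp add: ba m_assoc)
  finally show ?thesis
    by (simp add: z_def int_pow_mult)
qed

lemma gen_square: "g x \<otimes> g x = z (wt_a x) (wt_b x)"
  by (cases x) (simp_all add: z_def c_square)

text \<open>Up to a central factor each generator is its own inverse; this is why the stack may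
  ignore the signs of letters.\<close>

lemma inv_gen: "inv (g x) = g x \<otimes> z (- wt_a x) (- wt_b x)"
proof (rule inv_equality)
  have "g x \<otimes> z (- wt_a x) (- wt_b x) \<otimes> g x = g x \<otimes> g x \<otimes> z (- wt_a x) (- wt_b x)"
    by (simp add: m_assoc z_commute_gen)
  then show "g x \<otimes> z (- wt_a x) (- wt_b x) \<otimes> g x = \<one>"
    by (simp add: gen_square z_mult)
qed simp_all

section \<open>Words and their normal form\<close>

lemma letter_value_closed [simp]: "letter_value G g l \<in> carrier G"
  by (simp add: letter_value_def)

lemma word_value_simps [simp]:
  "word_value G g [] = \<one>"
  "word_value G g (l # u) = letter_value G g l \<otimes> word_value G g u"
  by (simp_all add: word_value_def)

lemma word_value_closed [simp]: "word_value G g u \<in> carrier G"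
  by (induction u) auto

lemma z_commute_letter: "z m n \<otimes> letter_value G g l = letter_value G g l \<otimes> z m n"
  using inv_commute[OF z_commute_gen[symmetric], of "fst l" m n]
  by (simp add: letter_value_def z_commute_gen)

lemma z_commute_word: "z m n \<otimes> word_value G g u = word_value G g u \<otimes> z m n"
proof (induction u)
  case (Cons l u)
  then show ?case
    by (simp add: m_assoc[symmetric] z_commute_letter) (simp add: m_assoc Cons)
qed simp

text \<open>The head of the stack is the rightmost factor, the place where the next letter of the
  word is multiplied.\<close>

primrec stack_value :: "torus_gen list \<Rightarrow> 'a" where
  "stack_value [] = \<one>"
| "stack_value (x # s) = stack_value s \<otimes> g x"

lemma stack_value_closed [simp]: "stack_value s \<in> carrier G"
  by (induction s) auto

text \<open>A central factor arises in two cases: a positive letter meeting its own generator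
  completes a square, and an inverse letter that is pushed is replaced by the generator. The
  equations hold because each \<open>a\<^sup>2\<close> or \<open>b\<^sup>2\<close> contributes 2 to
  its exponent sum.\<close>

lemma stack_value_step:
  "\<exists>m n. stack_value s \<otimes> letter_value G g (x, e) = stack_value (toggle x s) \<otimes> z m n \<and>
    exponent wt_a [(x, e)] + sum_list (map wt_a s) = sum_list (map wt_a (toggle x s)) + 2 * m \<and>
    exponent wt_b [(x, e)] + sum_list (map wt_b s) = sum_list (map wt_b (toggle x s)) + 2 * n"
proof (cases "\<exists>t. s = x # t")
  case True
  then obtain t where s: "s = x # t" by blast
  show ?thesis
  proof (cases e)
    case True
    have "stack_value t \<otimes> g x \<otimes> g x = stack_value t \<otimes> z (wt_a x) (wt_b x)"
      by (simp add: m_assoc gen_square)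
    then show ?thesis
      by (intro exI[of _ "wt_a x"] exI[of _ "wt_b x"]) (simp add: s True letter_value_def)
  next
    case False
    then show ?thesis
      by (intro exI[of _ 0]) (simp add: s m_assoc letter_value_def)
  qed
next
  case False
  then have toggle: "toggle x s = x # s" by (cases s) auto
  show ?thesis
  proof (cases e)
    case True
    then show ?thesis
      by (intro exI[of _ 0]) (simp add: toggle letter_value_def)
  next
    case False
    then show ?thesis
      by (intro exI[of _ "- wt_a x"] exI[of _ "- wt_b x"])
        (simp add: toggle letter_value_def inv_gen m_assoc)
  qed
qed

text \<open>The linear equations add up along the word, so the exponent sums and the final stack
  determine the central coordinates \<open>m\<close> and \<open>n\<close>.\<close>

lemma stack_value_word:
  "\<exists>m n. stack_value s \<otimes> word_value G g u = stack_value (fold toggle (map fst u) s) \<otimes> z m n \<and>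
    exponent wt_a u + sum_list (map wt_a s) = sum_list (map wt_a (fold toggle (map fst u) s)) + 2 * m \<and>
    exponent wt_b u + sum_list (map wt_b s) = sum_list (map wt_b (fold toggle (map fst u) s)) + 2 * n"
proof (induction u arbitrary: s)
  case Nil
  show ?case by (intro exI[of _ 0]) simp
next
  case (Cons l u)
  obtain x e where l: "l = (x, e)" by (cases l)
  let ?s = "toggle x s" and ?t = "fold toggle (map fst u) (toggle x s)"
  from stack_value_step[of s x e] obtain m n where
    mn: "stack_value s \<otimes> letter_value G g (x, e) = stack_value ?s \<otimes> z m n"
      "exponent wt_a [(x, e)] + sum_list (map wt_a s) = sum_list (map wt_a ?s) + 2 * m"
      "exponent wt_b [(x, e)] + sum_list (map wt_b s) = sum_list (map wt_b ?s) + 2 * n"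
    by blast
  from Cons[of ?s] obtain m' n' where
    mn': "stack_value ?s \<otimes> word_value G g u = stack_value ?t \<otimes> z m' n'"
      "exponent wt_a u + sum_list (map wt_a ?s) = sum_list (map wt_a ?t) + 2 * m'"
      "exponent wt_b u + sum_list (map wt_b ?s) = sum_list (map wt_b ?t) + 2 * n'"
    by blast
  have "stack_value s \<otimes> word_value G g (l # u) = stack_value ?s \<otimes> z m n \<otimes> word_value G g u"
    by (simp add: l m_assoc[symmetric] mn(1))
  also have "\<dots> = stack_value ?s \<otimes> word_value G g u \<otimes> z m n"
    by (simp add: m_assoc z_commute_word)
  also have "\<dots> = stack_value ?t \<otimes> z (m' + m) (n' + n)"
    by (simp add: mn'(1) m_assoc z_mult)
  finally show ?case
    using mn(2,3) mn'(2,3)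
    by (intro exI[of _ "m' + m"] exI[of _ "n' + n"]) (simp add: l)
qed

text \<open>With an empty stack the equations read 0 = 2m and 0 = 2n; as \<int> has no torsion, the
  remaining central factor is \<open>z 0 0\<close>.\<close>

lemma word_value_eq_one:
  assumes "fold toggle (map fst u) [] = []" "exponent wt_a u = 0" "exponent wt_b u = 0"
  shows "word_value G g u = \<one>"
  using stack_value_word[of "[]" u] assms by auto

end

section \<open>The presented group as an instance\<close>

lemma pos_word_relation:
  assumes "(pos_word xs, pos_word ys) \<in> R"
  shows "foldr (\<lambda>x U. pres_gen R x \<otimes>\<^bsub>presented_group R\<^esub> U) xs \<one>\<^bsub>presented_group R\<^esub>
    = foldr (\<lambda>x U. pres_gen R x \<otimes>\<^bsub>presented_group R\<^esub> U) ys \<one>\<^bsub>presented_group R\<^esub>"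
proof -
  have "foldr (\<lambda>x U. pres_gen R x \<otimes>\<^bsub>presented_group R\<^esub> U) xs \<one>\<^bsub>presented_group R\<^esub>
      = pres_rel R `` {pos_word xs}" for xs
    by (simp flip: word_value_presented_group add: word_value_def foldr_map letter_value_def comp_def)
  then show ?thesis
    using pc_rel[OF assms] by (simp add: pres_class_eq_iff)
qed

lemma pres_gen_closed: "pres_gen R x \<in> carrier (presented_group R)"
  by (auto simp: pres_gen_def presented_group_def quotient_def)

lemma square_central_group_B2_torus: "square_central_group B2_torus B2_torus_gen"
proof -
  interpret group B2_torus
    unfolding B2_torus_def by (rule group_presented_group)
  have closed [simp]: "B2_torus_gen x \<in> carrier B2_torus" for x
    unfolding B2_torus_def B2_torus_gen_def by (rule pres_gen_closed)
  \<comment> \<open>On explicit lists \<open>foldr\<close> simplifies to the products that occur in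
    the locale assumptions.\<close>
  have rel: "foldr (\<lambda>x U. B2_torus_gen x \<otimes>\<^bsub>B2_torus\<^esub> U) xs \<one>\<^bsub>B2_torus\<^esub>
      = foldr (\<lambda>x U. B2_torus_gen x \<otimes>\<^bsub>B2_torus\<^esub> U) ys \<one>\<^bsub>B2_torus\<^esub>"
    if "(pos_word xs, pos_word ys) \<in> B2_torus_relations" for xs ys
    using pos_word_relation[OF that] by (simp only: B2_torus_def B2_torus_gen_def)
  have "(pos_word [A, A, B], pos_word [B, A, A]) \<in> B2_torus_relations"
    "(pos_word [B, B, A], pos_word [A, B, B]) \<in> B2_torus_relations"
    "(pos_word [A, A, C], pos_word [C, A, A]) \<in> B2_torus_relations"
    "(pos_word [B, B, C], pos_word [C, B, B]) \<in> B2_torus_relations"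
    "(pos_word [A, A, B, B], pos_word [C, C]) \<in> B2_torus_relations"
    by (simp_all add: B2_torus_relations_def)
  note rels = this[THEN rel]
  show ?thesis
  proof
    fix x
    show "B2_torus_gen A \<otimes>\<^bsub>B2_torus\<^esub> B2_torus_gen A \<otimes>\<^bsub>B2_torus\<^esub> B2_torus_gen x =
        B2_torus_gen x \<otimes>\<^bsub>B2_torus\<^esub> (B2_torus_gen A \<otimes>\<^bsub>B2_torus\<^esub> B2_torus_gen A)"
      \<comment> \<open>The case \<open>A\<close> is associativity; \<open>B\<close> and
        \<open>C\<close> are defining relations.\<close>
      using rels by (cases x) (simp_all add: m_assoc)
    show "B2_torus_gen B \<otimes>\<^bsub>B2_torus\<^esub> B2_torus_gen B \<otimes>\<^bsub>B2_torus\<^esub> B2_torus_gen x =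
        B2_torus_gen x \<otimes>\<^bsub>B2_torus\<^esub> (B2_torus_gen B \<otimes>\<^bsub>B2_torus\<^esub> B2_torus_gen B)"
      using rels by (cases x) (simp_all add: m_assoc)
    show "B2_torus_gen C \<otimes>\<^bsub>B2_torus\<^esub> B2_torus_gen C =
        B2_torus_gen A \<otimes>\<^bsub>B2_torus\<^esub> B2_torus_gen A \<otimes>\<^bsub>B2_torus\<^esub>
        (B2_torus_gen B \<otimes>\<^bsub>B2_torus\<^esub> B2_torus_gen B)"
      using rels by (simp add: m_assoc)
  qed simp
qed

lemma word_value_B2_torus_eq_one_iff:
  "word_value B2_torus B2_torus_gen u = \<one>\<^bsub>B2_torus\<^esub> \<longleftrightarrow>
    fold toggle (map fst u) [] = [] \<and> exponent wt_a u = 0 \<and> exponent wt_b u = 0"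
proof
  assume "word_value B2_torus B2_torus_gen u = \<one>\<^bsub>B2_torus\<^esub>"
  then have cong: "pres_cong B2_torus_relations u []"
    unfolding B2_torus_def B2_torus_gen_def word_value_presented_group
    by (simp add: presented_group_def pres_class_eq_iff)
  \<comment> \<open>In every relation the squares act as the identity on reduced stacks, so both
    sides act as the same single letter or both as the identity.\<close>
  have "fold toggle (map fst u) [] = fold toggle (map fst ([] :: torus_gen word)) []"
    by (rule pres_cong_fold_toggle[OF cong])
      (auto simp: B2_torus_relations_def toggle_toggle distinct_adj_toggle)
  moreover have "exponent wt_a u = exponent wt_a []" "exponent wt_b u = exponent wt_b []"
    by (rule pres_cong_exponent[OF cong]; auto simp: B2_torus_relations_def)+
  ultimately show "fold toggle (map fst u) [] = [] \<and> exponent wt_a u = 0 \<and> exponent wt_b u = 0"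
    by simp
next
  interpret square_central_group B2_torus B2_torus_gen
    by (rule square_central_group_B2_torus)
  assume "fold toggle (map fst u) [] = [] \<and> exponent wt_a u = 0 \<and> exponent wt_b u = 0"
  then show "word_value B2_torus B2_torus_gen u = \<one>\<^bsub>B2_torus\<^esub>"
    using word_value_eq_one by blast
qed


section \<open>The algorithm\<close>

text \<open>Exponent sums may be negative, so positive and inverse letters are counted separately in
  \<nat>. Two codes suffice because each weight is nonzero on exactly two generators.\<close>

definition count_codes :: "nat \<Rightarrow> nat \<Rightarrow> nat \<Rightarrow> nat" where
  "count_codes i j N = (\<Sum>x\<leftarrow>list_decode N. if x = i then 1 else if x = j then 1 else 0)"

text \<open>The letters \<open>a, b, c\<close> have the codes 1, 3, 5 and their inverses the codes 0, 2, 4.  Truncated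
  subtraction in both directions makes the result vanish iff the two counts agree.\<close>

definition torus_excess :: "nat \<Rightarrow> nat" where
  "torus_excess N = list_encode (fold toggle (map (\<lambda>x. x div 2) (list_decode N)) []) +
    ((count_codes 1 5 N - count_codes 0 4 N) + (count_codes 0 4 N - count_codes 1 5 N)) +
    ((count_codes 3 5 N - count_codes 2 4 N) + (count_codes 2 4 N - count_codes 3 5 N))"

lemma recursive_count_codes: "recursive n F \<Longrightarrow> recursive n (\<lambda>xs. count_codes i j (F xs))"
  unfolding count_codes_def
  by (intro recursive_sum_list recursive_if_eq recursive_const recursive_proj) auto

lemma recursive_torus_excess: "recursive n F \<Longrightarrow> recursive n (\<lambda>xs. torus_excess (F xs))"
  unfolding torus_excess_def
  by (intro recursive_add recursive_diff recursive_count_codes recursive_fold_toggle recursive_div2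
      recursive_proj) auto

section \<open>Correctness of the algorithm\<close>

lemma count_codes_word_code:
  "int (count_codes 1 5 (word_code torus_gen_num u)) - int (count_codes 0 4 (word_code torus_gen_num u))
    = exponent wt_a u"
  "int (count_codes 3 5 (word_code torus_gen_num u)) - int (count_codes 2 4 (word_code torus_gen_num u))
    = exponent wt_b u"
proof -
  have *: "count_codes i j (word_code torus_gen_num u) =
    (\<Sum>(x, e)\<leftarrow>u. if 2 * torus_gen_num x + of_bool e = i then 1
      else if 2 * torus_gen_num x + of_bool e = j then 1 else 0)" for i j
    by (simp add: count_codes_def word_code_def comp_def case_prod_unfold)
  show "int (count_codes 1 5 (word_code torus_gen_num u)) - int (count_codes 0 4 (word_code torus_gen_num u))
    = exponent wt_a u"
    unfolding *
  proof (induction u)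
    case (Cons l u)
    obtain x e where "l = (x, e)" by (cases l)
    then show ?case using Cons by (cases x; cases e) simp_all
  qed simp
  show "int (count_codes 3 5 (word_code torus_gen_num u)) - int (count_codes 2 4 (word_code torus_gen_num u))
    = exponent wt_b u"
    unfolding *
  proof (induction u)
    case (Cons l u)
    obtain x e where "l = (x, e)" by (cases l)
    then show ?case using Cons by (cases x; cases e) simp_all
  qed simp
qed

lemma inj_torus_gen_num: "inj torus_gen_num"
proof (rule injI)
  show "x = y" if "torus_gen_num x = torus_gen_num y" for x y
    using that by (cases x; cases y) simp_all
qed

lemma torus_excess_word_code:
  "torus_excess (word_code torus_gen_num u) = 0 \<longleftrightarrow>
    fold toggle (map fst u) [] = [] \<and> exponent wt_a u = 0 \<and> exponent wt_b u = 0"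
proof -
  \<comment> \<open>Halving a letter code drops the bit for the sign and leaves the number of the
    generator.\<close>
  have "map (\<lambda>x. x div 2) (list_decode (word_code torus_gen_num u)) = map torus_gen_num (map fst u)"
    by (auto simp: word_code_def case_prod_unfold)
  then have "fold toggle (map (\<lambda>x. x div 2) (list_decode (word_code torus_gen_num u))) []
      = map torus_gen_num (fold toggle (map fst u) [])"
    by (simp only: map_fold_toggle[OF inj_torus_gen_num] list.map)
  moreover have "list_encode xs = 0 \<longleftrightarrow> xs = []" for xs
    by (cases xs) auto
  ultimately have "list_encode (fold toggle (map (\<lambda>x. x div 2)
      (list_decode (word_code torus_gen_num u))) []) = 0 \<longleftrightarrow> fold toggle (map fst u) [] = []"
    by (simp only: map_is_Nil_conv)
  moreover have "a - b = 0 \<and> b - a = 0 \<longleftrightarrow> int a - int b = 0" for a b :: nat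
    by auto
  ultimately show ?thesis
    by (simp only: torus_excess_def add_is_0 count_codes_word_code conj_assoc[symmetric])
qed

theorem corollary4p6:
  "solvable_word_problem torus_gen_num B2_torus B2_torus_gen"
proof -
  have "recursive 1 (\<lambda>xs. if torus_excess (xs ! 0) = 0 then 1 else 0)"
    by (intro recursive_if_zero recursive_torus_excess recursive_proj recursive_const) simp
  then obtain f where
    "\<And>xs. length xs = 1 \<Longrightarrow> rec_eval f xs (if torus_excess (xs ! 0) = 0 then 1 else 0)"
    unfolding recursive_def by blast
  from this[of "[_]"] have f: "rec_eval f [N] (if torus_excess N = 0 then 1 else 0)" for N
    by simp
  show ?thesis
    unfolding solvable_word_problem_def
    using f[of "word_code torus_gen_num _"]
    by (intro exI[of _ f]) (simp only: word_value_B2_torus_eq_one_iff torus_excess_word_code simp_thms)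
qed

end
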